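(* Let $f:\mathbb{R}^n\to\mathbb{R}^n$ and let $s:\mathbb{R}^n\to\mathbb{R}^n$ have an inverse $s^{-1}$. Assume that: (H0) the problem $f(x)=0$, $x\in\mathbb{R}^n$, has a solution, denoted by $x^*$, and there exists $r>0$ such that $f$ is continuously differentiable on $D_1:=B(x^*,r)$; (H1) $J_f(x)$ is nonsingular for all $x\in D_1$ and there exists $\gamma_1>0$ such that $\|J_f(x)^{-1}\|\le\gamma_1$ for all $x\in D_1$; (H2) $s$ is a $\mathcal{C}^1$-homeomorphism from $D_1$ to $s(D_1)$ and there exists $\gamma_2>0$ such that $\|J_s(x)\|\le\gamma_2$ for all $x\in D_1$; (H3) with $D_2:=s(D_1)$, there exist $\beta_1,\beta_2>0$ such that $\|J_f(x)-J_f(x')\|\le\beta_1\|x-x'\|$ for all $x,x'\in D_1$ and $\|J_{s^{-1}}(z)-J_{s^{-1}}(z')\|\le\beta_2\|z-z'\|$ for all $z,z'\in D_2$. Then the sequence $(x^k)$ given by the rule: for $x^k\in D_1$, $$x^{k+1}:=s^{-1}\left(s(x^k)-J_s(x^k)[J_f(x^k)]^{-1}f(x^k)\right),$$ is well defined and converges quadratically to $x^*$.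
   Context: $\|\cdot\|$ is the Euclidean norm on $\mathbb{R}^n$ and, for matrices, the induced norm $\|A\|=\max\{\|Ax\|:\|x\|\le1\}$. $B(x,r)=\{z\in\mathbb{R}^n:\|z-x\|<r\}$ is the open ball. $J_h(x)$ denotes the Jacobian matrix of $h$ at $x$ (row $i$ is the transposed gradient of $h_i$). A map $h:A\to B$ with $A,B\subset\mathbb{R}^n$ is a $\mathcal{C}^1$-homeomorphism from $A$ to $B$ if it is bijective, $h$ is continuously differentiable on $A$, and $h^{-1}$ is continuously differentiable on $B$. A sequence $(x^k)$ converging to $x^*$, with $x^k\ne x^*$ for all $k$, is said to converge to $x^*$ with order $\alpha>0$ and asymptotic error constant $\lambda>0$ if $\lim_{k\to\infty}\|x^{k+1}-x^*\|/\|x^k-x^*\|^{\alpha}=\lambda$; when $\alpha=2$ the convergence is called quadratic.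
   Formalization: Proved for x^0 close enough to x^* (arctan, s=id fails from some x^0 in D_1); "quadratically" means ||x^{k+1}-x^*|| <= C||x^k-x^*||^2 and any order is >= 2, since a limit lambda>0 with x^k != x^* fails for f(x)=x+x^3, s=id. *)

theory Defs
  imports "HOL-Analysis.Analysis"
begin

(* Row i of J h x is the transposed gradient of the i-th component of h at x. *)
abbreviation J :: "(real^'n \<Rightarrow> real^'n) \<Rightarrow> real^'n \<Rightarrow> real^'n^'n"
  where "J h x \<equiv> jacobian h (at x)"

(* The type class norm on real^'n^'n is not the norm induced by the Euclidean norm,
   so the induced norm is taken from the operator norm of the associated linear map. *)
definition mat_norm :: "real^'n^'n \<Rightarrow> real"
  where "mat_norm A = onorm (\<lambda>v. A *v v)"

(* Two-sided derivatives are used: the notion is meant for open sets A. *)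
definition C1_on :: "(real^'n \<Rightarrow> real^'n) \<Rightarrow> (real^'n) set \<Rightarrow> bool"
  where "C1_on h A \<longleftrightarrow> (\<forall>x\<in>A. h differentiable (at x)) \<and> continuous_on A (J h)"

definition C1_homeomorphism ::
    "(real^'n \<Rightarrow> real^'n) \<Rightarrow> (real^'n) set \<Rightarrow> (real^'n) set \<Rightarrow> bool"
  where "C1_homeomorphism h A B \<longleftrightarrow>
    bij_betw h A B \<and> C1_on h A \<and> C1_on (inv_into A h) B"

definition newton_step ::
    "(real^'n \<Rightarrow> real^'n) \<Rightarrow> (real^'n \<Rightarrow> real^'n) \<Rightarrow> real^'n \<Rightarrow> real^'n"
  where "newton_step f s x =
    inv s (s x - J s x *v (matrix_inv (J f x) *v f x))"

(* X is the sequence produced by the rule from x0. The rule applies only to points of D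
   with nonsingular Jacobian, so both are required of every iterate: an infinite run exists
   only if the iteration never leaves D. *)
definition newton_sequence ::
    "(real^'n \<Rightarrow> real^'n) \<Rightarrow> (real^'n \<Rightarrow> real^'n) \<Rightarrow> (real^'n) set \<Rightarrow> real^'n
      \<Rightarrow> (nat \<Rightarrow> real^'n) \<Rightarrow> bool"
  where "newton_sequence f s D x0 X \<longleftrightarrow> X 0 = x0 \<and>
    (\<forall>k. X k \<in> D \<and> invertible (J f (X k)) \<and> X (Suc k) = newton_step f s (X k))"

definition converges_with_order ::
    "(nat \<Rightarrow> real^'n) \<Rightarrow> real^'n \<Rightarrow> real \<Rightarrow> real \<Rightarrow> bool"
  where "converges_with_order X L \<alpha> lam \<longleftrightarrow>
    \<alpha> > 0 \<and> lam > 0 \<and> X \<longlonglongrightarrow> L \<and> (\<forall>k. X k \<noteq> L) \<and>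
    (\<lambda>k. norm (X (Suc k) - L) / norm (X k - L) powr \<alpha>) \<longlonglongrightarrow> lam"

(* Under Lipschitz hypotheses on Jacobians, a Newton-type iteration may hit its limit after
   finitely many steps (f = id, s = id), may have order greater than 2 (f x = x + x^3, s = id),
   and norm (X (Suc k) - L) / (norm (X k - L))^2 need not have a limit. What holds in general
   is that this ratio stays bounded and that the order, whenever the sequence has one in the
   sense of converges_with_order, is at least 2. *)
definition converges_quadratically :: "(nat \<Rightarrow> real^'n) \<Rightarrow> real^'n \<Rightarrow> bool"
  where "converges_quadratically X L \<longleftrightarrow>
    X \<longlonglongrightarrow> L \<and>
    (\<exists>C>0. \<forall>k. norm (X (Suc k) - L) \<le> C * (norm (X k - L))\<^sup>2) \<and>
    (\<forall>\<alpha> lam. converges_with_order X L \<alpha> lam \<longrightarrow> \<alpha> \<ge> 2)"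

end

theory Submission
  imports Defs
begin

text \<open>
  Put \<open>g = s\<^sup>-\<^sup>1\<close> and let \<open>N = J\<^sub>f(x)\<^sup>-\<^sup>1 f(x)\<close> be the classical Newton correction at \<open>x\<close>. The
  chain rule gives \<open>J\<^sub>g(s x) J\<^sub>s(x) = I\<close>, so linearizing \<open>g\<close> at \<open>s x\<close> turns the new iterate
  \<open>g(s x - J\<^sub>s(x) N)\<close> into \<open>x - N\<close>, the ordinary Newton iterate. The error made is
  quadratic in \<open>N\<close> because \<open>J\<^sub>g\<close> is Lipschitz. The ordinary Newton iterate in turn misses
  \<open>x\<^sup>*\<close> by a term quadratic in \<open>x - x\<^sup>*\<close>, because \<open>J\<^sub>f\<close> is Lipschitz, and hence
  \<open>\<parallel>N\<parallel> \<le> 2 \<parallel>x - x\<^sup>*\<parallel>\<close> close to \<open>x\<^sup>*\<close>. Both estimates are instances of the Taylor bound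
  \<open>linearization_error_of_lipschitz_jacobian\<close>, and together they give
  \<open>transformed_newton_step_error\<close>.

  The linearization of \<open>g\<close> is only legitimate along a segment that stays in \<open>s(D\<^sub>1)\<close>. This set
  need not be convex, but it is open by invariance of domain, so it contains a ball around
  \<open>s(x\<^sup>*)\<close>, and both \<open>s x\<close> and \<open>s x - J\<^sub>s(x) N\<close> lie in that ball once \<open>x\<close> is close enough to
  \<open>x\<^sup>*\<close>.

  Finally, a quadratic error bound makes the step a contraction towards \<open>x\<^sup>*\<close> on a small ball.
  The iteration therefore never leaves that ball, and it converges.
\<close>

section \<open>Matrix norms and linearization\<close>

lemma norm_matrix_vector_le_mat_norm:
  fixes A :: "real^'n^'n"
  shows "norm (A *v v) \<le> mat_norm A * norm v"
  unfolding mat_norm_def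
  by (rule onorm) (rule matrix_vector_mul_bounded_linear)

lemma norm_matrix_vector_le:
  fixes A :: "real^'n^'n"
  assumes "mat_norm A \<le> c"
  shows "norm (A *v v) \<le> c * norm v"
  using norm_matrix_vector_le_mat_norm[of A v] mult_right_mono[OF assms norm_ge_zero[of v]]
  by linarith

lemma matrix_inv_left_inverse:
  fixes A :: "real^'n^'n"
  assumes "invertible A"
  shows "matrix_inv A ** A = mat 1"
  using assms unfolding invertible_def matrix_inv_def by (rule someI2_ex) simp

lemma has_derivative_jacobian:
  fixes h :: "real^'n \<Rightarrow> real^'n"
  assumes "h differentiable (at x)"
  shows "(h has_derivative (\<lambda>v. J h x *v v)) (at x)"
  using assms jacobian_works by blast

lemma lipschitz_of_bounded_jacobian:
  fixes h :: "real^'n \<Rightarrow> real^'n"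
  assumes "convex S"
    and "\<And>x. x \<in> S \<Longrightarrow> h differentiable (at x)"
    and "\<And>x. x \<in> S \<Longrightarrow> mat_norm (J h x) \<le> c"
    and "x \<in> S" "y \<in> S"
  shows "norm (h x - h y) \<le> c * norm (x - y)"
proof (rule differentiable_bound[OF \<open>convex S\<close> _ _ \<open>x \<in> S\<close> \<open>y \<in> S\<close>])
  fix u assume "u \<in> S"
  then show "(h has_derivative (\<lambda>v. J h u *v v)) (at u within S)"
    using assms(2) has_derivative_at_withinI has_derivative_jacobian by blast
  show "onorm (\<lambda>v. J h u *v v) \<le> c"
    using assms(3)[OF \<open>u \<in> S\<close>] by (simp add: mat_norm_def)
qed

text \<open>
  On the segment from \<open>x\<close> to \<open>y\<close> the Jacobian differs from \<open>J\<^sub>h(x)\<close> by at most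
  \<open>\<beta> \<parallel>y - x\<parallel>\<close>, and the mean value inequality for \<open>h - J\<^sub>h(x)\<close> contributes the second factor
  \<open>\<parallel>y - x\<parallel>\<close>. (Integrating along the segment would improve the constant to \<open>\<beta> / 2\<close>.)
\<close>

lemma linearization_error_of_lipschitz_jacobian:
  fixes h :: "real^'n \<Rightarrow> real^'n"
  assumes "convex S"
    and diff: "\<And>u. u \<in> S \<Longrightarrow> h differentiable (at u)"
    and lip: "\<And>u v. u \<in> S \<Longrightarrow> v \<in> S \<Longrightarrow> mat_norm (J h u - J h v) \<le> \<beta> * norm (u - v)"
    and "\<beta> \<ge> 0" and xy: "x \<in> S" "y \<in> S"
  shows "norm (h y - h x - J h x *v (y - x)) \<le> \<beta> * (norm (y - x))\<^sup>2"
proof -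
  let ?T = "closed_segment x y"
  have sub: "?T \<subseteq> S"
    using \<open>convex S\<close> xy by (simp add: closed_segment_subset)
  have "norm (h y - h x - J h x *v (y - x)) \<le> norm (y - x) * (\<beta> * norm (y - x))"
  proof (rule differentiable_bound_linearization[where S = ?T and f' = "\<lambda>u v. J h u *v v"])
    fix t :: real assume "t \<in> {0..1}"
    then show "x + t *\<^sub>R (y - x) \<in> ?T"
      unfolding closed_segment_def by (auto simp: algebra_simps intro!: exI[of _ t])
  next
    fix u assume u: "u \<in> ?T"
    then show "(h has_derivative (\<lambda>v. J h u *v v)) (at u within ?T)"
      using diff sub has_derivative_at_withinI has_derivative_jacobian by blast
    have "onorm (\<lambda>v. J h u *v v - J h x *v v) = mat_norm (J h u - J h x)"
      by (simp add: mat_norm_def matrix_vector_mult_diff_rdistrib)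
    also have "\<dots> \<le> \<beta> * norm (u - x)"
      using lip sub u xy by blast
    also have "\<dots> \<le> \<beta> * norm (y - x)"
      using segment_bound1[OF u] \<open>\<beta> \<ge> 0\<close> by (simp add: mult_left_mono)
    finally show "onorm ((\<lambda>v. J h u *v v) - (\<lambda>v. J h x *v v)) \<le> \<beta> * norm (y - x)"
      by (simp add: fun_diff_def)
  qed simp
  then show ?thesis
    by (simp add: power2_eq_square mult_ac)
qed

section \<open>Iterations with a quadratic error bound\<close>

text \<open>
  The hypothesis \<open>C \<delta> \<le> 1/2\<close> turns the quadratic bound into a contraction by the factor \<open>1/2\<close>
  towards \<open>L\<close> as long as the iterates stay in the ball, and the contraction keeps them there.
\<close>

lemma quadratic_iteration_halves_error:
  fixes X :: "nat \<Rightarrow> 'a::real_normed_vector"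
  assumes "X 0 \<in> ball L \<delta>" and "C * \<delta> \<le> 1/2" and "C \<ge> 0"
    and step: "\<And>k. X k \<in> ball L \<delta> \<Longrightarrow> norm (X (Suc k) - L) \<le> C * (norm (X k - L))\<^sup>2"
  shows "X k \<in> ball L \<delta> \<and> norm (X k - L) \<le> (1/2)^k * \<delta>"
proof (induction k)
  case 0
  then show ?case
    using assms(1) by (simp add: dist_norm norm_minus_commute less_imp_le)
next
  case (Suc k)
  then have lt: "norm (X k - L) < \<delta>"
    by (simp add: dist_norm norm_minus_commute)
  have "C * norm (X k - L) \<le> 1/2"
    using mult_left_mono[OF less_imp_le[OF lt] \<open>C \<ge> 0\<close>] assms(2) by linarith
  then have "C * norm (X k - L) * norm (X k - L) \<le> 1/2 * norm (X k - L)"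
    by (rule mult_right_mono) simp
  with step[of k] Suc have half: "norm (X (Suc k) - L) \<le> 1/2 * norm (X k - L)"
    by (simp add: power2_eq_square mult_ac)
  then have "norm (X (Suc k) - L) < \<delta>"
    using lt norm_ge_zero[of "X k - L"] by linarith
  moreover have "norm (X (Suc k) - L) \<le> (1/2)^Suc k * \<delta>"
    using half Suc by simp
  ultimately show ?case
    by (simp add: dist_norm norm_minus_commute)
qed

lemma quadratic_iteration_tendsto:
  fixes X :: "nat \<Rightarrow> 'a::real_normed_vector"
  assumes "X 0 \<in> ball L \<delta>" and "C * \<delta> \<le> 1/2" and "C \<ge> 0"
    and "\<And>k. X k \<in> ball L \<delta> \<Longrightarrow> norm (X (Suc k) - L) \<le> C * (norm (X k - L))\<^sup>2"
  shows "X \<longlonglongrightarrow> L"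
proof -
  have "(\<lambda>k. (1/2)^k * \<delta>) \<longlonglongrightarrow> 0"
    by (intro tendsto_mult_left_zero LIMSEQ_realpow_zero) auto
  then have "(\<lambda>k. X k - L) \<longlonglongrightarrow> 0"
    by (rule Lim_null_comparison[rotated])
      (use quadratic_iteration_halves_error[OF assms] in simp)
  then show ?thesis
    by (simp add: LIM_zero_iff)
qed

text \<open>
  If the order \<open>\<alpha>\<close> were below 2, then \<open>\<parallel>e\<^sub>k\<^sub>+\<^sub>1\<parallel> / \<parallel>e\<^sub>k\<parallel>\<^sup>\<alpha> \<le> C \<parallel>e\<^sub>k\<parallel>\<^bsup>2 - \<alpha>\<^esup>\<close> would tend to 0,
  which contradicts a positive asymptotic error constant.
\<close>

lemma order_ge_2_of_quadratic_bound:
  assumes bound: "\<And>k. norm (X (Suc k) - L) \<le> C * (norm (X k - L))\<^sup>2"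
    and conv: "converges_with_order X L \<alpha> lam"
  shows "\<alpha> \<ge> 2"
proof (rule ccontr)
  assume "\<not> \<alpha> \<ge> 2"
  have lam: "lam > 0" and lim: "X \<longlonglongrightarrow> L" and ne: "\<And>k. X k \<noteq> L"
    and q: "(\<lambda>k. norm (X (Suc k) - L) / norm (X k - L) powr \<alpha>) \<longlonglongrightarrow> lam"
    using conv by (auto simp: converges_with_order_def)
  have "(\<lambda>k. norm (X k - L)) \<longlonglongrightarrow> 0"
    using lim by (simp add: LIM_zero tendsto_norm_zero)
  then have "(\<lambda>k. norm (X k - L) powr (2 - \<alpha>)) \<longlonglongrightarrow> 0"
    using \<open>\<not> \<alpha> \<ge> 2\<close> by (intro tendsto_zero_powrI[where b = "2 - \<alpha>"]) auto
  then have "(\<lambda>k. C * norm (X k - L) powr (2 - \<alpha>)) \<longlonglongrightarrow> 0"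
    by (rule tendsto_mult_right_zero)
  moreover have "norm (X (Suc k) - L) / norm (X k - L) powr \<alpha>
      \<le> C * norm (X k - L) powr (2 - \<alpha>)" for k
  proof -
    have pos: "norm (X k - L) > 0"
      using ne by simp
    have "norm (X k - L) powr (2 - \<alpha>) = (norm (X k - L))\<^sup>2 / norm (X k - L) powr \<alpha>"
      using pos by (simp add: powr_diff)
    then show ?thesis
      using divide_right_mono[OF bound[of k], of "norm (X k - L) powr \<alpha>"] by simp
  qed
  ultimately have "lam \<le> 0"
    using q LIMSEQ_le by blast
  with lam show False
    by simp
qed

section \<open>One step of the transformed Newton method\<close>

text \<open>
  Because \<open>f(x\<^sup>*) = 0\<close>, the error left after a classical Newton step is exactly \<open>J\<^sub>f(x)\<^sup>-\<^sup>1\<close>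
  applied to the error of linearizing \<open>f\<close> at \<open>x\<close>, evaluated at \<open>x\<^sup>*\<close>.
\<close>

lemma newton_error:
  fixes f :: "real^'n \<Rightarrow> real^'n"
  assumes "convex S" and "\<And>u. u \<in> S \<Longrightarrow> f differentiable (at u)"
    and "\<And>u v. u \<in> S \<Longrightarrow> v \<in> S \<Longrightarrow> mat_norm (J f u - J f v) \<le> \<beta> * norm (u - v)"
    and "\<beta> \<ge> 0" and "x \<in> S" "xs \<in> S" and "f xs = 0"
    and inv: "invertible (J f x)" and bound: "mat_norm (matrix_inv (J f x)) \<le> \<gamma>" and "\<gamma> \<ge> 0"
  shows "norm (x - matrix_inv (J f x) *v f x - xs) \<le> \<gamma> * \<beta> * (norm (x - xs))\<^sup>2"
proof -
  let ?A = "J f x"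
  let ?R = "f xs - f x - ?A *v (xs - x)"
  have "matrix_inv ?A *v (?A *v (x - xs)) = x - xs"
    using matrix_inv_left_inverse[OF inv] by (simp add: matrix_vector_mul_assoc)
  then have "matrix_inv ?A *v (?A *v (x - xs) - f x) = x - xs - matrix_inv ?A *v f x"
    by (simp only: matrix_vector_mult_diff_distrib[of "matrix_inv ?A"])
  moreover have "x - matrix_inv ?A *v f x - xs = x - xs - matrix_inv ?A *v f x"
    by simp
  moreover have "?R = ?A *v (x - xs) - f x"
    using \<open>f xs = 0\<close> by (simp add: algebra_simps)
  ultimately have "x - matrix_inv ?A *v f x - xs = matrix_inv ?A *v ?R"
    by (simp only:)
  also have "norm \<dots> \<le> \<gamma> * norm ?R"
    by (rule norm_matrix_vector_le[OF bound])
  also have "\<dots> \<le> \<gamma> * (\<beta> * (norm (xs - x))\<^sup>2)"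
    using assms by (intro mult_left_mono linearization_error_of_lipschitz_jacobian) auto
  finally show ?thesis
    by (simp add: norm_minus_commute mult.assoc)
qed

text \<open>
  Invariance of domain makes \<open>s(D)\<close> open, and thus the branch of the inverse over \<open>D\<close> agrees
  with the global inverse on a neighbourhood of each point of \<open>s(D)\<close>, so that its
  derivatives carry over.
\<close>

lemma C1_homeomorphism_global_inverse:
  fixes s :: "real^'n \<Rightarrow> real^'n"
  assumes hom: "C1_homeomorphism s D (s ` D)" and "open D" and "inj s"
  shows "open (s ` D)"
    and "\<And>z. z \<in> s ` D \<Longrightarrow> inv s differentiable (at z)"
    and "\<And>x v. x \<in> D \<Longrightarrow> J (inv s) (s x) *v (J s x *v v) = v"
proof -
  have s_diff: "s differentiable (at x)" if "x \<in> D" for x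
    using hom that by (simp add: C1_homeomorphism_def C1_on_def)
  have "continuous_on D s"
    using s_diff differentiable_imp_continuous_within continuous_at_imp_continuous_on by blast
  then show op: "open (s ` D)"
    using \<open>open D\<close> \<open>inj s\<close> by (meson invariance_of_domain inj_on_subset subset_UNIV)
  show g_diff: "inv s differentiable (at z)" if z: "z \<in> s ` D" for z
  proof -
    have "inv_into D s differentiable (at z)"
      using hom z unfolding C1_homeomorphism_def C1_on_def by blast
    then have "(inv_into D s has_derivative (\<lambda>v. J (inv_into D s) z *v v)) (at z)"
      by (rule has_derivative_jacobian)
    then have "(inv s has_derivative (\<lambda>v. J (inv_into D s) z *v v)) (at z)"
      by (rule has_derivative_transform_within_open[OF _ op z])
        (use \<open>inj s\<close> in \<open>auto simp: inv_into_f_f inj_on_subset\<close>)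
    then show ?thesis
      by (auto simp: differentiable_def)
  qed
  show "J (inv s) (s x) *v (J s x *v v) = v" if x: "x \<in> D" for x v
  proof -
    have "(inv s \<circ> s has_derivative (\<lambda>v. J (inv s) (s x) *v v) \<circ> (\<lambda>v. J s x *v v)) (at x)"
      using x by (intro diff_chain_at has_derivative_jacobian s_diff g_diff) auto
    moreover have "inv s \<circ> s = id"
      using \<open>inj s\<close> by simp
    ultimately have "((\<lambda>v. J (inv s) (s x) *v v) \<circ> (\<lambda>v. J s x *v v)) = id"
      by (metis has_derivative_id has_derivative_unique eq_id_iff)
    then show ?thesis
      by (metis comp_apply id_apply)
  qed
qed

text \<open>
  The new iterate differs from \<open>x\<^sup>*\<close> by the error of the classical Newton step plus the error of
  linearizing \<open>s\<^sup>-\<^sup>1\<close> at \<open>s x\<close> over the displacement \<open>J\<^sub>s(x) N\<close>. The latter is at most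
  \<open>\<beta>2 (\<gamma>2 \<parallel>N\<parallel>)\<^sup>2 \<le> \<beta>2 (2 \<gamma>2 \<parallel>x - x\<^sup>*\<parallel>)\<^sup>2\<close>; here \<open>\<gamma>1 \<beta>1 \<parallel>x - x\<^sup>*\<parallel> \<le> 1\<close> gives
  \<open>\<parallel>N\<parallel> \<le> 2 \<parallel>x - x\<^sup>*\<parallel>\<close>. The hypothesis on \<open>\<rho>\<close> keeps the displaced point within the ball about
  \<open>s(x\<^sup>*)\<close>, at distance at most \<open>\<gamma>2 \<parallel>x - x\<^sup>*\<parallel> + 2 \<gamma>2 \<parallel>x - x\<^sup>*\<parallel>\<close> from its centre.
\<close>

lemma transformed_newton_step_error:
  fixes f s :: "real^'n \<Rightarrow> real^'n"
  assumes "convex D" "open D" and "inj s"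
    and f_diff: "\<And>u. u \<in> D \<Longrightarrow> f differentiable (at u)"
    and f_lip: "\<And>u v. u \<in> D \<Longrightarrow> v \<in> D \<Longrightarrow> mat_norm (J f u - J f v) \<le> \<beta>1 * norm (u - v)"
    and x: "x \<in> D" and xs: "xs \<in> D" "f xs = 0"
    and f_inv: "invertible (J f x)" "mat_norm (matrix_inv (J f x)) \<le> \<gamma>1"
    and hom: "C1_homeomorphism s D (s ` D)"
    and s_bound: "\<And>u. u \<in> D \<Longrightarrow> mat_norm (J s u) \<le> \<gamma>2"
    and g_lip: "\<And>z z'. z \<in> s ` D \<Longrightarrow> z' \<in> s ` D \<Longrightarrow>
      mat_norm (J (inv s) z - J (inv s) z') \<le> \<beta>2 * norm (z - z')"
    and nonneg: "\<beta>1 \<ge> 0" "\<beta>2 \<ge> 0" "\<gamma>1 \<ge> 0" "\<gamma>2 \<ge> 0"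
    and \<rho>: "ball (s xs) \<rho> \<subseteq> s ` D" "3 * \<gamma>2 * norm (x - xs) < \<rho>"
    and close: "\<gamma>1 * \<beta>1 * norm (x - xs) \<le> 1"
  shows "norm (newton_step f s x - xs) \<le> (\<gamma>1 * \<beta>1 + 4 * \<beta>2 * \<gamma>2\<^sup>2) * (norm (x - xs))\<^sup>2"
proof -
  define e where "e = norm (x - xs)"
  define N where "N = matrix_inv (J f x) *v f x"
  define w where "w = s x - J s x *v N"
  have e: "e \<ge> 0"
    by (simp add: e_def)
  have newton: "norm (x - N - xs) \<le> \<gamma>1 * \<beta>1 * e\<^sup>2"
    unfolding N_def e_def
    using newton_error[OF \<open>convex D\<close> f_diff f_lip] x xs f_inv nonneg by blast
  also have "\<dots> \<le> e"
    using mult_right_mono[OF close[folded e_def] e] by (simp add: power2_eq_square mult_ac)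
  finally have N: "norm N \<le> 2 * e"
    using norm_triangle_ineq4[of "x - xs" "x - N - xs"] by (simp add: e_def)
  have s_diff: "\<And>u. u \<in> D \<Longrightarrow> s differentiable (at u)"
    using hom by (simp add: C1_homeomorphism_def C1_on_def)
  have sx: "norm (s x - s xs) \<le> \<gamma>2 * e"
    unfolding e_def
    by (rule lipschitz_of_bounded_jacobian[OF \<open>convex D\<close> s_diff s_bound x xs(1)])
  have "norm (J s x *v N) \<le> \<gamma>2 * norm N"
    by (rule norm_matrix_vector_le[OF s_bound[OF x]])
  then have JN: "norm (J s x *v N) \<le> 2 * \<gamma>2 * e"
    using mult_left_mono[OF N \<open>\<gamma>2 \<ge> 0\<close>] by simp
  have "0 \<le> \<gamma>2 * e"
    using nonneg e by simp
  then have "norm (s x - s xs) < \<rho>"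
    using sx \<rho>(2)[folded e_def] by linarith
  moreover have "norm (w - s xs) < \<rho>"
    using norm_triangle_ineq4[of "s x - s xs" "J s x *v N"] sx JN \<rho>(2)[folded e_def]
    by (simp add: w_def algebra_simps)
  ultimately have in_ball: "s x \<in> ball (s xs) \<rho>" "w \<in> ball (s xs) \<rho>"
    by (simp_all add: dist_norm norm_minus_commute)
  note inverse = C1_homeomorphism_global_inverse[OF hom \<open>open D\<close> \<open>inj s\<close>]
  have "norm (inv s w - inv s (s x) - J (inv s) (s x) *v (w - s x))
      \<le> \<beta>2 * (norm (w - s x))\<^sup>2"
    using \<rho>(1) inverse(2) nonneg in_ball
    by (intro linearization_error_of_lipschitz_jacobian[where S = "ball (s xs) \<rho>"] g_lip)
      blast+
  moreover have "J (inv s) (s x) *v (w - s x) = - N"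
    using inverse(3)[OF x, of N]
      matrix_vector_mult_diff_distrib[of "J (inv s) (s x)" 0 "J s x *v N"]
    by (simp add: w_def)
  moreover have "inv s (s x) = x"
    using \<open>inj s\<close> by simp
  ultimately have "norm (inv s w - (x - N)) \<le> \<beta>2 * (norm (J s x *v N))\<^sup>2"
    by (simp add: w_def algebra_simps)
  also have "\<dots> \<le> \<beta>2 * (2 * \<gamma>2 * e)\<^sup>2"
    using JN nonneg by (intro mult_left_mono power_mono) auto
  finally have "norm (inv s w - (x - N)) \<le> 4 * \<beta>2 * \<gamma>2\<^sup>2 * e\<^sup>2"
    by (simp add: power_mult_distrib mult_ac)
  then have "norm (inv s w - xs) \<le> 4 * \<beta>2 * \<gamma>2\<^sup>2 * e\<^sup>2 + \<gamma>1 * \<beta>1 * e\<^sup>2"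
    using newton norm_triangle_ineq[of "inv s w - (x - N)" "x - N - xs"] by simp
  then show ?thesis
    by (simp add: newton_step_def w_def N_def e_def algebra_simps)
qed

section \<open>Local quadratic convergence\<close>

theorem theorem2:
  fixes f s :: "real^'n \<Rightarrow> real^'n"
    and xs :: "real^'n"
    and r \<gamma>1 \<gamma>2 \<beta>1 \<beta>2 :: real
    and D1 D2 :: "(real^'n) set"
  assumes D1_eq: "D1 = ball xs r"
    and D2_eq: "D2 = s ` D1"
    and s_inv: "bij s"
    and H0: "f xs = 0" "r > 0" "C1_on f D1"
    and H1: "\<And>x. x \<in> D1 \<Longrightarrow> invertible (J f x)" "\<gamma>1 > 0"
      "\<And>x. x \<in> D1 \<Longrightarrow> mat_norm (matrix_inv (J f x)) \<le> \<gamma>1"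
    and H2: "C1_homeomorphism s D1 D2" "\<gamma>2 > 0"
      "\<And>x. x \<in> D1 \<Longrightarrow> mat_norm (J s x) \<le> \<gamma>2"
    and H3: "\<beta>1 > 0" "\<beta>2 > 0"
      "\<And>x x'. x \<in> D1 \<Longrightarrow> x' \<in> D1 \<Longrightarrow> mat_norm (J f x - J f x') \<le> \<beta>1 * norm (x - x')"
      "\<And>z z'. z \<in> D2 \<Longrightarrow> z' \<in> D2 \<Longrightarrow>
        mat_norm (J (inv s) z - J (inv s) z') \<le> \<beta>2 * norm (z - z')"
  shows "\<exists>\<delta>>0. \<forall>x0\<in>ball xs \<delta>.
    (\<exists>!X. newton_sequence f s D1 x0 X) \<and>
    (\<forall>X. newton_sequence f s D1 x0 X \<longrightarrow> converges_quadratically X xs)"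
proof -
  have inj: "inj s"
    using s_inv by (rule bij_is_inj)
  have D1: "convex D1" "open D1" "xs \<in> D1"
    using D1_eq H0(2) by auto
  have hom: "C1_homeomorphism s D1 (s ` D1)"
    using H2(1) D2_eq by simp
  have f_diff: "\<And>x. x \<in> D1 \<Longrightarrow> f differentiable (at x)"
    using H0(3) by (simp add: C1_on_def)
  have "open (s ` D1)"
    by (rule C1_homeomorphism_global_inverse(1)[OF hom D1(2) inj])
  then obtain \<rho> where \<rho>: "\<rho> > 0" "ball (s xs) \<rho> \<subseteq> s ` D1"
    using D1(3) open_contains_ball by blast
  define C where "C = \<gamma>1 * \<beta>1 + 4 * \<beta>2 * \<gamma>2\<^sup>2"
  have C: "C > 0"
    using H1(2) H2(2) H3(1,2) by (simp add: C_def add_pos_nonneg)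
  \<comment> \<open>\<open>1 / (2 C)\<close> yields the contraction and also \<open>\<gamma>1 \<beta>1 \<delta> \<le> 1\<close>, because \<open>\<gamma>1 \<beta>1 \<le> C\<close>.\<close>
  define \<delta> where "\<delta> = min r (min (\<rho> / (3 * \<gamma>2)) (1 / (2 * C)))"
  have \<delta>: "\<delta> > 0" "\<delta> \<le> r" "\<delta> \<le> \<rho> / (3 * \<gamma>2)" "\<delta> \<le> 1 / (2 * C)"
    using H0(2) \<rho>(1) H2(2) C by (auto simp: \<delta>_def)
  have C\<delta>: "C * \<delta> \<le> 1/2"
    using \<delta>(4) C by (simp add: field_simps)
  have sub: "ball xs \<delta> \<subseteq> D1"
    using \<delta>(2) D1_eq by (simp add: subset_ball)
  have step: "norm (newton_step f s x - xs) \<le> C * (norm (x - xs))\<^sup>2"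
    if x: "x \<in> ball xs \<delta>" for x
  proof -
    have lt: "norm (x - xs) < \<delta>"
      using x by (simp add: dist_norm norm_minus_commute)
    have "3 * \<gamma>2 * norm (x - xs) < \<rho>"
      using less_le_trans[OF lt \<delta>(3)] H2(2) by (simp add: field_simps)
    moreover have "\<gamma>1 * \<beta>1 * norm (x - xs) \<le> C * \<delta>"
      using lt C H1(2) H2(2) H3(1,2) by (intro mult_mono) (auto simp: C_def)
    then have "\<gamma>1 * \<beta>1 * norm (x - xs) \<le> 1"
      using C\<delta> by linarith
    ultimately show ?thesis
      unfolding C_def
      using x sub D1 inj f_diff H0(1) H1 hom H2 H3 D2_eq \<rho>(2)
      by (intro transformed_newton_step_error[where D = D1 and \<rho> = \<rho>]) auto
  qed
  show ?thesis
  proof (intro exI[of _ \<delta>] conjI ballI \<delta>(1))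
    fix x0 assume x0: "x0 \<in> ball xs \<delta>"
    define X where "X = (\<lambda>k. (newton_step f s ^^ k) x0)"
    have "X 0 = x0" and X_Suc: "\<And>k. X (Suc k) = newton_step f s (X k)"
      by (simp_all add: X_def)
    have in_ball: "X k \<in> ball xs \<delta>" for k
      using quadratic_iteration_halves_error[of X xs \<delta> C k] x0 \<open>X 0 = x0\<close> C C\<delta> step X_Suc
      by auto
    have X: "newton_sequence f s D1 x0 X"
      using in_ball sub H1(1) X_Suc \<open>X 0 = x0\<close> unfolding newton_sequence_def by blast
    have unique: "Y = X" if "newton_sequence f s D1 x0 Y" for Y
    proof
      show "Y k = X k" for k
        using that by (induction k) (auto simp: newton_sequence_def X_def)
    qed
    show "\<exists>!X. newton_sequence f s D1 x0 X"
      using X unique by blast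
    have bound: "norm (X (Suc k) - xs) \<le> C * (norm (X k - xs))\<^sup>2" for k
      using step[OF in_ball] X_Suc by simp
    have "X \<longlonglongrightarrow> xs"
      by (rule quadratic_iteration_tendsto[where X = X, OF in_ball C\<delta> less_imp_le[OF C]])
        (rule bound)
    then have "converges_quadratically X xs"
      unfolding converges_quadratically_def
      using C bound order_ge_2_of_quadratic_bound[where X = X, OF bound] by blast
    then show "\<forall>X. newton_sequence f s D1 x0 X \<longrightarrow> converges_quadratically X xs"
      using unique by blast
  qed
qed

end
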